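(* Let $a>0$ and $b>0$. With $V(p,n,a,\beta,x)$ and $\Upsilon_e,\Upsilon_o$ as defined in the context, the following hold on $(0,\infty)$: (i) for $p\in\{0,1,2\}$, $$\sqrt{2\pi}\int x^{\frac12+p}e^{-ax^{2}}b^{\frac12}I_{\frac12}(bx)\,dx=\int 2e^{-ax^{2}}x^{p}\sinh(bx)\,dx=V(p,0,a,-b,x)-V(p,0,a,b,x);$$ (ii) $$\sqrt{2\pi}\int x^{\frac12-1}e^{-ax^{2}}b^{\frac32}I_{\frac32}(bx)\,dx=\int\frac bx e^{-ax^{2}}\left(2\cosh(bx)-\frac{2\sinh(bx)}{bx}\right)dx$$ $$=\frac{\sqrt\pi\sqrt a\,x\,e^{\frac{b^{2}}{4a}}\operatorname{erf}\left(\frac{2ax-b}{2\sqrt a}\right)+e^{bx-ax^{2}}}{x}-\frac{\sqrt\pi\sqrt a\,x\,e^{\frac{b^{2}}{4a}}\operatorname{erf}\left(\frac{2ax+b}{2\sqrt a}\right)+e^{-ax^{2}-bx}}{x}=V(-1,1,a,b,x)-V(-1,1,a,-b,x);$$ (iii) $$\sqrt{2\pi}\int x^{\frac12}e^{-ax^{2}}b^{\frac32}I_{\frac32}(bx)\,dx=\int be^{-ax^{2}}\left(2\cosh(bx)-\frac{2\sinh(bx)}{bx}\right)dx=2b\,\Upsilon_e(0,a,b,x)+2\,\Upsilon_o(1,a,b,x).$$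
   Context: $I_\mu$ is the modified Bessel function of the first kind; $\operatorname{erf}(z)=\frac{2}{\sqrt\pi}\int_0^z e^{-t^2}dt$; $\Gamma(s,z)=\int_z^\infty t^{s-1}e^{-t}dt$. For real $\beta$, with $E=e^{-ax^{2}-\beta x}$ and $W=\sqrt\pi\,e^{\frac{\beta^{2}}{4a}}\operatorname{erf}\left(\frac{2ax+\beta}{2\sqrt a}\right)$: $$V(0,0,a,\beta,x)=\frac{W}{2\sqrt a},\quad V(1,0,a,\beta,x)=-\frac{E}{2a}-\frac{\beta W}{4a^{3/2}},$$ $$V(2,0,a,\beta,x)=\frac{(\beta-2ax)E}{4a^{2}}+\frac{(2a+\beta^{2})W}{8a^{5/2}},\quad V(-1,1,a,\beta,x)=-\sqrt a\,W-\frac Ex.$$ For $x>0$, $$\Upsilon_e(\upsilon,a,b,x)=-\sum_{k=0}^\infty\frac{b^{2k}a^{-k+\frac\upsilon2-\frac12}\Gamma\left(k-\frac\upsilon2+\frac12,ax^2\right)}{2(2k)!},\quad \Upsilon_o(\upsilon,a,b,x)=\sum_{k=0}^\infty\frac{b^{2k+1}a^{-k+\frac\upsilon2-1}\Gamma\left(k-\frac\upsilon2+1,ax^2\right)}{2(2k+1)!}.$$ An identity $\int f\,dx=\int g\,dx=F$ means that $f=g$ on $(0,\infty)$ and $F$ is an antiderivative of it there. *)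

theory Defs
  imports "HOL-Analysis.Analysis"
begin

(* The power series of I_mu, for real order and x > 0; rGamma is the reciprocal
   Gamma function, so terms at poles of Gamma vanish. *)
definition bessel_I :: "real \<Rightarrow> real \<Rightarrow> real" where
  "bessel_I \<mu> x = (\<Sum>k. (x / 2) powr (2 * real k + \<mu>) * rGamma (real k + \<mu> + 1) / fact k)"

(* The interval integral is oriented, so this is also right for z < 0. *)
definition erf :: "real \<Rightarrow> real" where
  "erf z = 2 / sqrt pi * (LBINT t=ereal 0..ereal z. exp (- (t\<^sup>2)))"

definition upper_Gamma :: "real \<Rightarrow> real \<Rightarrow> real" where
  "upper_Gamma s z = (LBINT t=ereal z..\<infinity>. t powr (s - 1) * exp (- t))"

definition V_E :: "real \<Rightarrow> real \<Rightarrow> real \<Rightarrow> real" where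
  "V_E a \<beta> x = exp (- a * x\<^sup>2 - \<beta> * x)"

definition V_W :: "real \<Rightarrow> real \<Rightarrow> real \<Rightarrow> real" where
  "V_W a \<beta> x = sqrt pi * exp (\<beta>\<^sup>2 / (4 * a)) * erf ((2 * a * x + \<beta>) / (2 * sqrt a))"

(* Only the four index pairs (p, n) below are specified. *)
definition V :: "int \<Rightarrow> nat \<Rightarrow> real \<Rightarrow> real \<Rightarrow> real \<Rightarrow> real" where
  "V p n a \<beta> x =
    (if p = 0 \<and> n = 0 then V_W a \<beta> x / (2 * sqrt a)
     else if p = 1 \<and> n = 0 then
       - V_E a \<beta> x / (2 * a) - \<beta> * V_W a \<beta> x / (4 * a powr (3/2))
     else if p = 2 \<and> n = 0 then
       (\<beta> - 2 * a * x) * V_E a \<beta> x / (4 * a\<^sup>2)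
         + (2 * a + \<beta>\<^sup>2) * V_W a \<beta> x / (8 * a powr (5/2))
     else if p = -1 \<and> n = 1 then - sqrt a * V_W a \<beta> x - V_E a \<beta> x / x
     else undefined)"

definition Upsilon_e :: "real \<Rightarrow> real \<Rightarrow> real \<Rightarrow> real \<Rightarrow> real" where
  "Upsilon_e \<upsilon> a b x =
    - (\<Sum>k. b ^ (2 * k) * a powr (- real k + \<upsilon> / 2 - 1 / 2)
             * upper_Gamma (real k - \<upsilon> / 2 + 1 / 2) (a * x\<^sup>2) / (2 * fact (2 * k)))"

definition Upsilon_o :: "real \<Rightarrow> real \<Rightarrow> real \<Rightarrow> real \<Rightarrow> real" where
  "Upsilon_o \<upsilon> a b x =
    (\<Sum>k. b ^ (2 * k + 1) * a powr (- real k + \<upsilon> / 2 - 1)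
           * upper_Gamma (real k - \<upsilon> / 2 + 1) (a * x\<^sup>2) / (2 * fact (2 * k + 1)))"

(* The reading of an identity between indefinite integrals
   "int f dx = int g dx = F" on (0, infinity). *)
definition integral_identity :: "(real \<Rightarrow> real) \<Rightarrow> (real \<Rightarrow> real) \<Rightarrow> (real \<Rightarrow> real) \<Rightarrow> bool" where
  "integral_identity f g F \<longleftrightarrow>
    (\<forall>x>0. f x = g x) \<and> (\<forall>x>0. (F has_real_derivative f x) (at x))"

end

(* At orders 1/2 and 3/2 the Bessel series collapses to sinh and cosh because
   Gamma (k + 1/2) = sqrt pi * (2k)! / (4^k * k!); the same identity turns the majorant
   Gamma (k + 1/2) >= upper_Gamma (k + 1/2) z into an exponential series.  Hence Upsilon_e 0
   and Upsilon_o 1 can be differentiated term by term, and their derivatives are Gaussian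
   multiples of the series of cosh (b x) and - sinh (b x) / x. *)

theory Submission
  imports Defs
begin

section \<open>Hyperbolic series and Gamma at half-integers\<close>

text \<open>\<open>sinh_converges\<close> sums over all powers with zeros at the even ones;
  reindexing along the strictly monotone map \<open>2 * k + 1\<close> skips those zeros. The series
  for cosh is treated in the same way.\<close>

lemma sinh_sums:
  fixes x :: real
  shows "(\<lambda>k. x ^ (2 * k + 1) / fact (2 * k + 1)) sums sinh x"
proof -
  have "(\<lambda>k. if even (2 * k + 1) then 0 else x ^ (2 * k + 1) /\<^sub>R fact (2 * k + 1)) sums sinh x"
    by (subst sums_mono_reindex[where f = "\<lambda>n. if even n then 0 else x ^ n /\<^sub>R fact n"])
       (auto simp: strict_mono_def sinh_converges elim!: oddE)
  then show ?thesis
    by (simp add: divide_inverse mult.commute)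
qed

lemma cosh_sums:
  fixes x :: real
  shows "(\<lambda>k. x ^ (2 * k) / fact (2 * k)) sums cosh x"
proof -
  have "(\<lambda>k. if even (2 * k) then x ^ (2 * k) /\<^sub>R fact (2 * k) else 0) sums cosh x"
    by (subst sums_mono_reindex[where f = "\<lambda>n. if even n then x ^ n /\<^sub>R fact n else 0"])
       (auto simp: strict_mono_def cosh_converges elim!: evenE)
  then show ?thesis
    by (simp add: divide_inverse mult.commute)
qed

lemma Gamma_half_plus_nat:
  "Gamma (real k + 1/2) = sqrt pi * fact (2 * k) / (4 ^ k * fact k)"
proof (induction k)
  case 0
  show ?case by (simp add: Gamma_one_half_real)
next
  case (Suc k)
  have "Gamma (real (Suc k) + 1/2) = Gamma ((real k + 1/2) + 1)"
    by (simp add: add_ac)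
  also have "\<dots> = (real k + 1/2) * Gamma (real k + 1/2)"
    by (rule Gamma_plus1) (auto elim!: nonpos_Ints_cases')
  \<comment> \<open>The factorials advance by (2k+2)(2k+1) = 4 (k+1) (k+1/2), which matches the new
    factor k+1/2 once 4 (k+1) is absorbed into the denominator.\<close>
  also have "\<dots> = (real k + 1/2) * (sqrt pi * fact (2 * k) / (4 ^ k * fact k))"
    by (simp only: Suc)
  also have "\<dots> = sqrt pi * fact (2 * Suc k) / (4 ^ Suc k * fact (Suc k))"
    by (simp add: divide_simps) (simp add: algebra_simps)
  finally show ?case .
qed

lemma Gamma_three_halves_plus_nat:
  "Gamma (real k + 1/2 + 1) = (real k + 1/2) * (sqrt pi * fact (2 * k) / (4 ^ k * fact k))"
  unfolding Gamma_half_plus_nat[symmetric]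
  by (rule Gamma_plus1) (auto elim!: nonpos_Ints_cases')

section \<open>Closed forms of the Bessel functions of orders 1/2 and 3/2\<close>

text \<open>Term by term, 4^k k! from the Gamma value cancels against (x/2)^(2k) / k!, and the
  factor k+1/2 completes (2k)! to (2k+1)!, leaving the sinh series.\<close>

lemma bessel_I_one_half:
  assumes "x > 0"
  shows "bessel_I (1/2) x = sqrt (2 / (pi * x)) * sinh x"
proof -
  have "(x / 2) powr (2 * real k + 1/2) * rGamma (real k + 1/2 + 1) / fact k
        = sqrt (2 / (pi * x)) * (x ^ (2 * k + 1) / fact (2 * k + 1))" for k
  proof -
    have "(x / 2) powr (2 * real k + 1/2) = (x / 2) ^ (2 * k) * sqrt (x / 2)"
      using assms by (simp add: powr_add powr_half_sqrt flip: powr_realpow)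
    moreover have "(x / 2) ^ (2 * k) = x ^ (2 * k) / 4 ^ k"
      by (simp add: power_divide power_mult)
    \<comment> \<open>Splits off the prefactor of the closed form; the remaining
      \<open>sqrt pi\<close> cancels against Gamma and x/2 supplies the odd power of x.\<close>
    moreover have "sqrt (x / 2) = sqrt (2 / (pi * x)) * (sqrt pi * x / 2)"
      by (rule real_sqrt_unique)
         (use assms in \<open>simp_all add: power2_eq_square field_simps real_sqrt_divide real_sqrt_mult\<close>)
    ultimately show ?thesis
      unfolding rGamma_inverse_Gamma Gamma_three_halves_plus_nat using assms
      by (simp add: divide_simps) (simp add: algebra_simps)
  qed
  then have "bessel_I (1/2) x = (\<Sum>k. sqrt (2 / (pi * x)) * (x ^ (2 * k + 1) / fact (2 * k + 1)))"
    unfolding bessel_I_def by presburger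
  also have "\<dots> = sqrt (2 / (pi * x)) * sinh x"
    by (intro sums_unique[symmetric] sums_mult sinh_sums)
  finally show ?thesis .
qed

text \<open>The series of cosh x - sinh x / x has coefficients 1/(2k)! - 1/(2k+1)!. Its term at
  index 0 vanishes, and its term at index k+1 is, up to the prefactor, the Bessel term at index
  k.\<close>

lemma bessel_I_three_halves:
  assumes "x > 0"
  shows "bessel_I (3/2) x = sqrt (2 / (pi * x)) * (cosh x - sinh x / x)"
proof -
  let ?t = "\<lambda>k. x ^ (2 * k) / fact (2 * k) - x ^ (2 * k + 1) / fact (2 * k + 1) / x"
  have Gam: "Gamma (real k + 3/2 + 1)
      = (real k + 3/2) * ((real k + 1/2) * (sqrt pi * fact (2 * k) / (4 ^ k * fact k)))" for k
  proof -
    have "Gamma (real k + 1/2 + 1 + 1) = (real k + 1/2 + 1) * Gamma (real k + 1/2 + 1)"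
      by (rule Gamma_plus1) (auto elim!: nonpos_Ints_cases')
    then show ?thesis
      unfolding Gamma_three_halves_plus_nat by (simp add: add_ac)
  qed
  have "?t sums (cosh x - sinh x / x)"
    by (intro sums_diff sums_divide cosh_sums sinh_sums)
  moreover have "?t 0 = 0"
    using assms by simp
  ultimately have shifted: "(\<lambda>k. ?t (Suc k)) sums (cosh x - sinh x / x)"
    using sums_Suc_iff[of ?t "cosh x - sinh x / x"] by simp
  have "(x / 2) powr (2 * real k + 3/2) * rGamma (real k + 3/2 + 1) / fact k
        = sqrt (2 / (pi * x)) * ?t (Suc k)" for k
  proof -
    \<comment> \<open>The odd factors 2k+3 and 2k+1: Gamma (k+5/2) is A B / 4 times Gamma (k+1/2).
      Keeping them opaque stops the simplifier from expanding the products.\<close>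
    define A where "A = 2 * real k + 3"
    define B where "B = 2 * real k + 1"
    have A: "A > 0" and B: "B > 0"
      by (simp_all add: A_def B_def)
    have "(x / 2) powr (2 * real k + 3/2) = (x / 2) powr (2 * real k + 1 + 1/2)"
      by (simp add: add.commute)
    also have "\<dots> = (x / 2) ^ (2 * k) * (x / 2) * sqrt (x / 2)"
      using assms by (simp only: powr_add) (simp add: powr_half_sqrt flip: powr_realpow)
    finally have power: "(x / 2) powr (2 * real k + 3/2) = (x / 2) ^ (2 * k) * (x / 2) * sqrt (x / 2)" .
    have even_power: "(x / 2) ^ (2 * k) = x ^ (2 * k) / 4 ^ k"
      by (simp add: power_divide power_mult)
    have root: "sqrt (x / 2) = sqrt (2 / (pi * x)) * (sqrt pi * x / 2)"
      by (rule real_sqrt_unique)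
         (use assms in \<open>simp_all add: power2_eq_square field_simps real_sqrt_divide real_sqrt_mult\<close>)
    have coeff: "?t (Suc k) = x ^ (2 * k) * x\<^sup>2 / (A * B * fact (2 * k))"
    proof -
      define C where "C = 2 * real k + 2"
      have C: "C > 0" "A = C + 1"
        by (simp_all add: A_def C_def)
      have facts: "fact (2 * Suc k) = C * B * (fact (2 * k) :: real)"
           "fact (2 * Suc k + 1) = A * (C * B * (fact (2 * k) :: real))"
        by (simp_all add: A_def B_def C_def algebra_simps)
      have powers: "x ^ (2 * Suc k) = x ^ (2 * k) * x\<^sup>2" "x ^ (2 * Suc k + 1) = x ^ (2 * k) * x\<^sup>2 * x"
        by (simp_all add: power2_eq_square)
      \<comment> \<open>The difference of reciprocal factorials telescopes: with A = C + 1, 1/C -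
        1/(C (C+1)) = 1/(C+1).\<close>
      have "?t (Suc k) = x ^ (2 * k) * x\<^sup>2 / (B * fact (2 * k)) * (1 / C - 1 / (A * C))"
        unfolding facts powers using assms by (simp add: right_diff_distrib diff_divide_distrib mult_ac)
      also have "1 / C - 1 / (A * C) = 1 / A"
        unfolding C(2) using C(1) by (simp add: divide_simps)
      finally show ?thesis
        by (simp add: mult_ac)
    qed
    have rGam: "rGamma (real k + 3/2 + 1) = 4 * 4 ^ k * fact k / (A * B * sqrt pi * fact (2 * k))"
    proof -
      have "real k + 3/2 = A / 2" "real k + 1/2 = B / 2"
        by (simp_all add: A_def B_def)
      then show ?thesis
        using Gam[of k] by (simp only: rGamma_inverse_Gamma) simp
    qed
    show ?thesis
      unfolding power even_power root coeff rGam
      using A B assms by (simp add: power2_eq_square mult_ac)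
  qed
  then have "bessel_I (3/2) x = (\<Sum>k. sqrt (2 / (pi * x)) * ?t (Suc k))"
    unfolding bessel_I_def by presburger
  also have "\<dots> = sqrt (2 / (pi * x)) * (cosh x - sinh x / x)"
    by (intro sums_unique[symmetric] sums_mult shifted)
  finally show ?thesis .
qed

section \<open>Derivatives of the error function and the upper incomplete Gamma function\<close>

text \<open>\<open>interval_integral_FTC2\<close> yields a derivative within [l, u]; as z is an
  interior point, this is a two-sided derivative. The point z may lie on either side of the base
  point c.\<close>

lemma has_real_derivative_interval_integral:
  fixes f :: "real \<Rightarrow> real"
  assumes "continuous_on {l..u} f" "l \<le> c" "c \<le> u" "l < z" "z < u"
  shows "((\<lambda>z. LBINT t=ereal c..ereal z. f t) has_real_derivative f z) (at z)"
  using interval_integral_FTC2[of l c u f z] assms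
  by (simp add: has_real_derivative_iff_has_vector_derivative at_within_Icc_at)

lemma has_real_derivative_erf:
  "(erf has_real_derivative 2 / sqrt pi * exp (- z\<^sup>2)) (at z)"
  unfolding erf_def [abs_def]
  \<comment> \<open>These bounds enclose both 0 and z, with z in the interior, whatever the sign of
    z.\<close>
  by (intro DERIV_cmult
      has_real_derivative_interval_integral[where l = "- \<bar>z\<bar> - 1" and u = "\<bar>z\<bar> + 1"]
      continuous_intros) auto

text \<open>The Gamma integral comes as a gauge integral; nonnegativity of the integrand makes it
  absolutely integrable, and Borel measurability allows passing from the completed measure to
  \<open>lborel\<close>.\<close>

lemma set_integrable_Gamma:
  fixes s z :: real
  assumes "s > 0" "z \<ge> 0"
  shows "set_integrable lborel {z<..} (\<lambda>t. t powr (s - 1) * exp (- t))"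
proof -
  let ?f = "\<lambda>t::real. t powr (s - 1) * exp (- t)"
  have "?f integrable_on {0..}"
    using Gamma_integral_real[OF assms(1)]
    by (auto simp: integrable_on_def exp_minus divide_inverse)
  then have "?f absolutely_integrable_on {0..}"
    by (intro nonnegative_absolutely_integrable_1) auto
  then have "set_integrable lborel {0..} ?f"
    unfolding set_integrable_def by (subst (asm) integrable_completion) measurable
  then show ?thesis
    by (rule set_integrable_subset) (use assms in auto)
qed

lemma upper_Gamma_nonneg: "0 \<le> upper_Gamma s z"
  unfolding upper_Gamma_def interval_integral_to_infinity_eq set_lebesgue_integral_def
  by (intro integral_nonneg_AE) auto

text \<open>The integrand is nonnegative, so enlarging the domain to {0..} can only increase the
  integral. This bound gives the majorant of the \<open>Upsilon_e\<close> and
  \<open>Upsilon_o\<close> series.\<close>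

lemma upper_Gamma_le_Gamma:
  assumes "s > 0" "z \<ge> 0"
  shows "upper_Gamma s z \<le> Gamma s"
proof -
  let ?f = "\<lambda>t::real. t powr (s - 1) * exp (- t)"
  have G: "(?f has_integral Gamma s) {0..}"
    using Gamma_integral_real[OF assms(1)] by (simp add: exp_minus divide_inverse)
  have "upper_Gamma s z = integral {z<..} ?f"
    unfolding upper_Gamma_def interval_integral_to_infinity_eq
    by (rule set_borel_integral_eq_integral(2)[OF set_integrable_Gamma[OF assms]])
  also have "\<dots> \<le> integral {0..} ?f"
    by (rule integral_subset_le)
       (use assms G set_borel_integral_eq_integral(1)[OF set_integrable_Gamma[OF assms]] in auto)
  also have "\<dots> = Gamma s"
    using G by (rule integral_unique)
  finally show ?thesis .
qed

text \<open>Splitting the improper integral at z makes its tail a constant, so only an integral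
  between finite endpoints is differentiated.\<close>

lemma has_real_derivative_upper_Gamma:
  assumes "s > 0" "z > 0"
  shows "(upper_Gamma s has_real_derivative - (z powr (s - 1) * exp (- z))) (at z)"
proof -
  let ?f = "\<lambda>t::real. t powr (s - 1) * exp (- t)"
  have split: "upper_Gamma s w = upper_Gamma s z - (LBINT t=ereal z..ereal w. ?f t)" if "w > 0" for w
  proof -
    \<comment> \<open>\<open>interval_integral_sum\<close> asks for integrability on the hull of the
      three endpoints z, w and infinity, which starts at the smaller of z and w.\<close>
    have "interval_lebesgue_integrable lborel (min z (min w \<infinity>)) (max z (max w \<infinity>)) ?f"
      using set_integrable_Gamma[of s "min z w"] assms that
      by (cases "z \<le> w") (simp_all add: interval_integrable_to_infinity_eq min_def)
    from interval_integral_sum[OF this] show ?thesis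
      unfolding upper_Gamma_def by simp
  qed
  \<comment> \<open>The lower bound z/2 keeps the interval away from 0, where
    \<open>t powr (s - 1)\<close> can be singular.\<close>
  have "((\<lambda>w. upper_Gamma s z - (LBINT t=ereal z..ereal w. ?f t)) has_real_derivative 0 - ?f z) (at z)"
    by (intro DERIV_diff DERIV_const
        has_real_derivative_interval_integral[where l = "z / 2" and u = "z + 1"] continuous_intros)
       (use assms in auto)
  then have "((\<lambda>w. upper_Gamma s z - (LBINT t=ereal z..ereal w. ?f t)) has_real_derivative - ?f z) (at z)"
    by simp
  then show ?thesis
    by (rule has_field_derivative_transform_within_open[of _ _ _ "{0<..}"])
       (use assms in \<open>simp_all add: split[symmetric]\<close>)
qed

section \<open>Termwise differentiation of the Upsilon series\<close>

text \<open>\<open>Upsilon_e 0\<close> and \<open>Upsilon_o 1\<close> share the Gamma parameter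
  k+1/2 and the power of a, so one lemma with free coefficients d serves both. The bound on d
  controls the series and the series of its derivatives.\<close>

lemma has_real_derivative_upper_Gamma_series:
  fixes d :: "nat \<Rightarrow> real"
  assumes a: "a > 0" and x: "x > 0"
    and d: "\<And>k. \<bar>d k\<bar> \<le> M * (b ^ (2 * k) / fact (2 * k))"
  shows "((\<lambda>x. \<Sum>k. d k * a powr (- real k - 1/2) * upper_Gamma (real k + 1/2) (a * x\<^sup>2) / 2)
           has_real_derivative (\<Sum>k. - (d k * x ^ (2 * k) * exp (- a * x\<^sup>2)))) (at x)"
proof -
  let ?f = "\<lambda>k x. d k * a powr (- real k - 1/2) * upper_Gamma (real k + 1/2) (a * x\<^sup>2) / 2"
  let ?f' = "\<lambda>k x. - (d k * x ^ (2 * k) * exp (- a * x\<^sup>2))"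
  \<comment> \<open>Boundedness of this neighbourhood of x gives the uniform bound y^(2k) <=
    (x+1)^(2k) for the M-test.\<close>
  let ?S = "{0<..<x + 1}"
  have deriv: "(?f k has_real_derivative ?f' k y) (at y within ?S)" if "y \<in> ?S" for k y
  proof -
    have y: "y > 0"
      using that by simp
    have "(?f k has_real_derivative
        d k * a powr (- real k - 1/2)
          * (- ((a * y\<^sup>2) powr (real k + 1/2 - 1) * exp (- (a * y\<^sup>2))) * (a * (2 * y))) / 2) (at y)"
      by (intro DERIV_cdivide DERIV_cmult DERIV_chain2[OF has_real_derivative_upper_Gamma])
         (use a y in \<open>auto intro!: derivative_eq_intros\<close>)
    also have "(a * y\<^sup>2) powr (real k + 1/2 - 1) = a powr (real k + 1/2 - 1) * (y\<^sup>2) powr (real k + 1/2 - 1)"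
      using a by (simp add: powr_mult)
    \<comment> \<open>The 1/y left here cancels against the inner derivative 2 a y, just as the
      powers of a cancel below.\<close>
    also have "(y\<^sup>2) powr (real k + 1/2 - 1) = y ^ (2 * k) / y"
    proof -
      have "y\<^sup>2 = y powr 2"
        using y by simp
      then have "(y\<^sup>2) powr (real k + 1/2 - 1) = y powr (2 * (real k + 1/2 - 1))"
        by (simp only: powr_powr)
      also have "2 * (real k + 1/2 - 1) = real (2 * k) - 1"
        by simp
      also have "y powr (real (2 * k) - 1) = y ^ (2 * k) / y"
        using y by (simp only: powr_diff powr_realpow powr_one)
      finally show ?thesis .
    qed
    finally have "(?f k has_real_derivative
        - (d k * (a powr (- real k - 1/2) * a powr (real k + 1/2 - 1) * a)
            * y ^ (2 * k) * exp (- a * y\<^sup>2))) (at y)"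
      using y by (simp add: mult_ac)
    moreover have "a powr (- real k - 1/2) * a powr (real k + 1/2 - 1) * a = 1"
    proof -
      have "a powr (- real k - 1/2) * a powr (real k + 1/2 - 1) * a
          = a powr (- real k - 1/2) * a powr (real k + 1/2 - 1) * a powr 1"
        using a by simp
      also have "\<dots> = a powr (- real k - 1/2 + (real k + 1/2 - 1) + 1)"
        by (simp only: powr_add)
      also have "\<dots> = 1"
        using a by simp
      finally show ?thesis .
    qed
    ultimately show ?thesis
      using has_field_derivative_at_within by simp
  qed
  have unif: "uniformly_convergent_on ?S (\<lambda>n y. \<Sum>k<n. ?f' k y)"
  proof (rule Weierstrass_m_test')
    fix k y
    assume y: "y \<in> ?S"
    have "norm (?f' k y) = \<bar>d k\<bar> * (y ^ (2 * k) * exp (- a * y\<^sup>2))"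
      using y by (simp add: abs_mult)
    also have "\<dots> \<le> (M * (b ^ (2 * k) / fact (2 * k))) * ((x + 1) ^ (2 * k) * 1)"
      \<comment> \<open>The \<open>order_trans\<close> fact gives nonnegativity of the majorant of
        \<open>d k\<close>, a side condition of \<open>mult_mono\<close>.\<close>
      using y a x d[of k] order_trans[OF abs_ge_zero d[of k]]
      by (intro mult_mono power_mono) auto
    finally show "norm (?f' k y) \<le> M * ((b * (x + 1)) ^ (2 * k) / fact (2 * k))"
      by (simp add: power_mult_distrib)
  next
    show "summable (\<lambda>k. M * ((b * (x + 1)) ^ (2 * k) / fact (2 * k)))"
      by (intro summable_mult sums_summable[OF cosh_sums])
  qed
  \<comment> \<open>Convergence at the single point x suffices beside \<open>unif\<close>. The Gamma
    value at k+1/2 cancels (2k)! and leaves an exponential series in b^2/(4a).\<close>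
  have summ: "summable (\<lambda>k. ?f k x)"
  proof (rule summable_comparison_test')
    show "summable (\<lambda>k. M * sqrt pi / (2 * sqrt a) * (inverse (fact k) * (b\<^sup>2 / (4 * a)) ^ k))"
      by (intro summable_mult summable_exp)
    fix k :: nat
    have a_powr: "a powr (- real k - 1/2) = 1 / (a ^ k * sqrt a)"
    proof -
      have "a powr (- real k - 1/2) = a powr - (real k + 1/2)"
        by simp
      also have "\<dots> = 1 / (a ^ k * sqrt a)"
        using a by (simp only: powr_minus powr_add powr_realpow powr_half_sqrt inverse_eq_divide)
      finally show ?thesis .
    qed
    have "norm (?f k x) = \<bar>d k\<bar> * (a powr (- real k - 1/2) * upper_Gamma (real k + 1/2) (a * x\<^sup>2) / 2)"
      by (simp add: abs_mult upper_Gamma_nonneg)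
    also have "\<dots> \<le> (M * (b ^ (2 * k) / fact (2 * k)))
        * (a powr (- real k - 1/2) * Gamma (real k + 1/2) / 2)"
      using a d[of k] order_trans[OF abs_ge_zero d[of k]]
      by (intro mult_mono divide_right_mono upper_Gamma_le_Gamma)
         (auto simp: upper_Gamma_nonneg)
    also have "M * (b ^ (2 * k) / fact (2 * k)) * (a powr (- real k - 1/2) * Gamma (real k + 1/2) / 2)
        = M * sqrt pi / (2 * sqrt a) * (inverse (fact k) * (b\<^sup>2 / (4 * a)) ^ k)"
      unfolding Gamma_half_plus_nat a_powr using a
      by (simp add: divide_simps power_mult power_mult_distrib)
    finally show "norm (?f k x) \<le> M * sqrt pi / (2 * sqrt a) * (inverse (fact k) * (b\<^sup>2 / (4 * a)) ^ k)" .
  qed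
  show "((\<lambda>x. \<Sum>k. ?f k x) has_real_derivative (\<Sum>k. ?f' k x)) (at x)"
    by (rule has_field_derivative_series'(2)[OF _ deriv unif _ summ]) (use x in auto)
qed

lemma has_real_derivative_Upsilon_e:
  assumes a: "a > 0" and x: "x > 0"
  shows "(Upsilon_e 0 a b has_real_derivative exp (- a * x\<^sup>2) * cosh (b * x)) (at x)"
proof -
  let ?d = "\<lambda>k. b ^ (2 * k) / fact (2 * k)"
  have "Upsilon_e 0 a b
      = (\<lambda>x. - (\<Sum>k. ?d k * a powr (- real k - 1/2) * upper_Gamma (real k + 1/2) (a * x\<^sup>2) / 2))"
    unfolding Upsilon_e_def by (intro ext arg_cong[where f = uminus] suminf_cong) simp
  moreover have "(\<Sum>k. - (?d k * x ^ (2 * k) * exp (- a * x\<^sup>2))) = - (exp (- a * x\<^sup>2) * cosh (b * x))"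
    using sums_minus[OF sums_mult[OF cosh_sums[of "b * x"], of "exp (- a * x\<^sup>2)"]]
    by (intro sums_unique[symmetric]) (simp add: power_mult_distrib mult_ac)
  ultimately show ?thesis
    using DERIV_minus[OF has_real_derivative_upper_Gamma_series[OF a x, of ?d 1 b]] by simp
qed

text \<open>The series carries b^(2k+1) but only x^(2k), so it sums to sinh (b x) / x. The
  coefficient bound holds with M = |b| because (2k)! <= (2k+1)!.\<close>

lemma has_real_derivative_Upsilon_o:
  assumes a: "a > 0" and x: "x > 0"
  shows "(Upsilon_o 1 a b has_real_derivative - (exp (- a * x\<^sup>2) * sinh (b * x) / x)) (at x)"
proof -
  let ?d = "\<lambda>k. b ^ (2 * k + 1) / fact (2 * k + 1)"
  have "Upsilon_o 1 a b
      = (\<lambda>x. (\<Sum>k. ?d k * a powr (- real k - 1/2) * upper_Gamma (real k + 1/2) (a * x\<^sup>2) / 2))"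
  proof -
    have exponents: "- real k + 1/2 - 1 = - real k - 1/2" "real k - 1/2 + 1 = real k + 1/2" for k
      by simp_all
    show ?thesis
      unfolding Upsilon_o_def exponents by (intro ext suminf_cong) simp
  qed
  moreover have "(\<Sum>k. - (?d k * x ^ (2 * k) * exp (- a * x\<^sup>2))) = - (exp (- a * x\<^sup>2) * sinh (b * x) / x)"
    using sums_minus[OF sums_divide[OF sums_mult[OF sinh_sums[of "b * x"], of "exp (- a * x\<^sup>2)"], of x]] x
    by (intro sums_unique[symmetric]) (simp add: power_mult_distrib mult_ac)
  moreover have "\<bar>?d k\<bar> \<le> \<bar>b\<bar> * (b ^ (2 * k) / fact (2 * k))" for k
  proof -
    have "(fact (2 * k) :: real) \<le> fact (2 * k + 1)"
      by (rule fact_mono) simp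
    moreover have "\<bar>b ^ (2 * k + 1)\<bar> = \<bar>b\<bar> * b ^ (2 * k)"
      by (simp add: abs_mult)
    ultimately show ?thesis
      by (simp add: frac_le del: fact_Suc power_Suc)
  qed
  ultimately show ?thesis
    using has_real_derivative_upper_Gamma_series[OF a x, of ?d "\<bar>b\<bar>" b] by simp
qed

section \<open>Derivatives of the functions V\<close>

lemma has_real_derivative_V_E:
  "(V_E a \<beta> has_real_derivative - (2 * a * x + \<beta>) * V_E a \<beta> x) (at x)"
  unfolding V_E_def [abs_def] by (auto intro!: derivative_eq_intros)

text \<open>Completing the square turns the Gaussian from erf, times the exponential prefactor, into
  \<open>V_E\<close>.\<close>

lemma has_real_derivative_V_W:
  assumes "a > 0"
  shows "(V_W a \<beta> has_real_derivative 2 * sqrt a * V_E a \<beta> x) (at x)"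
proof -
  let ?u = "\<lambda>x. (2 * a * x + \<beta>) / (2 * sqrt a)"
  have "(?u has_real_derivative sqrt a) (at x)"
    using assms by (auto intro!: derivative_eq_intros simp: real_div_sqrt)
  then have "((\<lambda>x. sqrt pi * exp (\<beta>\<^sup>2 / (4 * a)) * erf (?u x)) has_real_derivative
      sqrt pi * exp (\<beta>\<^sup>2 / (4 * a)) * (2 / sqrt pi * exp (- (?u x)\<^sup>2) * sqrt a)) (at x)"
    by (intro DERIV_cmult DERIV_chain2[OF has_real_derivative_erf])
  also have "sqrt pi * exp (\<beta>\<^sup>2 / (4 * a)) * (2 / sqrt pi * exp (- (?u x)\<^sup>2) * sqrt a)
      = 2 * sqrt a * exp (\<beta>\<^sup>2 / (4 * a) - (?u x)\<^sup>2)"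
    by (simp only: diff_conv_add_uminus exp_add) simp
  also have "\<beta>\<^sup>2 / (4 * a) - (?u x)\<^sup>2 = - a * x\<^sup>2 - \<beta> * x"
  proof -
    have "(?u x)\<^sup>2 = (2 * a * x + \<beta>)\<^sup>2 / (4 * a)"
      using assms by (simp add: power_divide power_mult_distrib)
    also have "\<dots> = a * x\<^sup>2 + \<beta> * x + \<beta>\<^sup>2 / (4 * a)"
      using assms by (simp add: power2_eq_square field_simps)
    finally show ?thesis
      by simp
  qed
  finally show ?thesis
    unfolding V_W_def [abs_def] V_E_def .
qed

text \<open>The derivatives of \<open>V_E\<close> and \<open>V_W\<close> are both multiples of
  \<open>V_E\<close>, so no erf term survives and each case is an identity of rational
  coefficients.\<close>

lemma has_real_derivative_V_nat:
  assumes "a > 0" "p \<in> {0, 1, 2 :: nat}"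
  shows "(V (int p) 0 a \<beta> has_real_derivative x ^ p * V_E a \<beta> x) (at x)"
proof -
  \<comment> \<open>In terms of s the fractional powers of a become integer powers, within reach of
    \<open>field_simps\<close>.\<close>
  define s where "s = sqrt a"
  have s: "s > 0" "a = s\<^sup>2"
    using assms(1) by (simp_all add: s_def)
  have powrs: "a powr (3/2) = s ^ 3" "a powr (5/2) = s ^ 5"
    using assms(1) by (simp_all add: s_def powr_powr flip: powr_half_sqrt powr_numeral)
  note E = has_real_derivative_V_E[of a \<beta> x]
  note W = has_real_derivative_V_W[OF assms(1), of \<beta> x, folded s_def]
  consider "p = 0" | "p = 1" | "p = 2"
    using assms(2) by auto
  then show ?thesis
  proof cases
    case 1
    have "((\<lambda>x. V_W a \<beta> x / (2 * s)) has_real_derivative 2 * s * V_E a \<beta> x / (2 * s)) (at x)"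
      by (rule DERIV_cdivide[OF W])
    then show ?thesis
      unfolding V_def [abs_def] s_def[symmetric] using 1 s(1) by simp
  next
    case 2
    have "((\<lambda>x. - V_E a \<beta> x / (2 * a) - \<beta> * V_W a \<beta> x / (4 * s ^ 3)) has_real_derivative
        - (- (2 * a * x + \<beta>) * V_E a \<beta> x) / (2 * a) - \<beta> * (2 * s * V_E a \<beta> x) / (4 * s ^ 3)) (at x)"
      by (intro DERIV_diff DERIV_cdivide DERIV_minus DERIV_cmult E W)
    also have "- (- (2 * a * x + \<beta>) * V_E a \<beta> x) / (2 * a) - \<beta> * (2 * s * V_E a \<beta> x) / (4 * s ^ 3)
        = x * V_E a \<beta> x"
      using s(1) unfolding s(2) by (simp add: field_simps eval_nat_numeral)
    finally show ?thesis
      unfolding V_def [abs_def] powrs using 2 by simp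
  next
    case 3
    have "((\<lambda>x. (\<beta> - 2 * a * x) * V_E a \<beta> x / (4 * a\<^sup>2) + (2 * a + \<beta>\<^sup>2) * V_W a \<beta> x / (8 * s ^ 5))
        has_real_derivative
        ((0 - 2 * a * 1) * V_E a \<beta> x + - (2 * a * x + \<beta>) * V_E a \<beta> x * (\<beta> - 2 * a * x)) / (4 * a\<^sup>2)
          + (2 * a + \<beta>\<^sup>2) * (2 * s * V_E a \<beta> x) / (8 * s ^ 5)) (at x)"
      by (intro DERIV_add DERIV_mult DERIV_diff DERIV_cdivide DERIV_cmult DERIV_const DERIV_ident E W)
    also have "((0 - 2 * a * 1) * V_E a \<beta> x + - (2 * a * x + \<beta>) * V_E a \<beta> x * (\<beta> - 2 * a * x)) / (4 * a\<^sup>2)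
          + (2 * a + \<beta>\<^sup>2) * (2 * s * V_E a \<beta> x) / (8 * s ^ 5) = x\<^sup>2 * V_E a \<beta> x"
      using s(1) unfolding s(2) by (simp add: field_simps eval_nat_numeral)
    finally show ?thesis
      unfolding V_def [abs_def] powrs using 3 by simp
  qed
qed

text \<open>The contribution -2a \<open>V_E\<close> of the erf term cancels the part 2a
  \<open>V_E\<close> that arises from differentiating -\<open>V_E\<close>/x.\<close>

lemma has_real_derivative_V_minus_one:
  assumes "a > 0" "x \<noteq> 0"
  shows "(V (-1) 1 a \<beta> has_real_derivative (\<beta> / x + 1 / x\<^sup>2) * V_E a \<beta> x) (at x)"
proof -
  note E = has_real_derivative_V_E[of a \<beta> x]
  note W = has_real_derivative_V_W[OF assms(1), of \<beta> x]
  have "((\<lambda>x. - sqrt a * V_W a \<beta> x - V_E a \<beta> x / x) has_real_derivative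
      - sqrt a * (2 * sqrt a * V_E a \<beta> x)
        - (- (2 * a * x + \<beta>) * V_E a \<beta> x * x - V_E a \<beta> x * 1) / (x * x)) (at x)"
    by (intro DERIV_diff DERIV_divide DERIV_cmult DERIV_ident E W assms(2))
  also have "- sqrt a * (2 * sqrt a * V_E a \<beta> x) = - 2 * a * V_E a \<beta> x"
    using assms(1) by simp
  also have "- 2 * a * V_E a \<beta> x - (- (2 * a * x + \<beta>) * V_E a \<beta> x * x - V_E a \<beta> x * 1) / (x * x)
      = (\<beta> / x + 1 / x\<^sup>2) * V_E a \<beta> x"
    using assms(2) by (simp add: field_simps power2_eq_square)
  finally show ?thesis
    unfolding V_def [abs_def] by simp
qed

section \<open>Passage to hyperbolic functions and assembly of the three identities\<close>

lemma V_E_sinh_cosh: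
  "V_E a (- b) x - V_E a b x = 2 * exp (- a * x\<^sup>2) * sinh (b * x)"
  "V_E a (- b) x + V_E a b x = 2 * exp (- a * x\<^sup>2) * cosh (b * x)"
  by (simp_all add: V_E_def sinh_field_def cosh_field_def exp_diff exp_add exp_minus field_simps)

theorem mainTheorem10:
  fixes a b :: real
  assumes "a > 0" and "b > 0"
  shows
    "(\<forall>p\<in>{0, 1, 2 :: nat}.
        integral_identity
          (\<lambda>x. sqrt (2 * pi) * (x powr (1/2 + real p) * exp (- a * x\<^sup>2)
                 * b powr (1/2) * bessel_I (1/2) (b * x)))
          (\<lambda>x. 2 * exp (- a * x\<^sup>2) * x ^ p * sinh (b * x))
          (\<lambda>x. V (int p) 0 a (- b) x - V (int p) 0 a b x))
     \<and>
     (let F = (\<lambda>x.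
            (sqrt pi * sqrt a * x * exp (b\<^sup>2 / (4 * a)) * erf ((2 * a * x - b) / (2 * sqrt a))
               + exp (b * x - a * x\<^sup>2)) / x
            - (sqrt pi * sqrt a * x * exp (b\<^sup>2 / (4 * a)) * erf ((2 * a * x + b) / (2 * sqrt a))
               + exp (- a * x\<^sup>2 - b * x)) / x)
      in integral_identity
           (\<lambda>x. sqrt (2 * pi) * (x powr (1/2 - 1) * exp (- a * x\<^sup>2)
                  * b powr (3/2) * bessel_I (3/2) (b * x)))
           (\<lambda>x. b / x * exp (- a * x\<^sup>2) * (2 * cosh (b * x) - 2 * sinh (b * x) / (b * x)))
           F
         \<and> (\<forall>x>0. F x = V (-1) 1 a b x - V (-1) 1 a (- b) x))
     \<and>
     integral_identity
       (\<lambda>x. sqrt (2 * pi) * (x powr (1/2) * exp (- a * x\<^sup>2)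
              * b powr (3/2) * bessel_I (3/2) (b * x)))
       (\<lambda>x. b * exp (- a * x\<^sup>2) * (2 * cosh (b * x) - 2 * sinh (b * x) / (b * x)))
       (\<lambda>x. 2 * b * Upsilon_e 0 a b x + 2 * Upsilon_o 1 a b x)"
proof -
  have integral_identityI: "integral_identity f g F"
    if "\<And>x. x > 0 \<Longrightarrow> f x = g x" "\<And>x. x > 0 \<Longrightarrow> (F has_real_derivative g x) (at x)" for f g F
    using that by (simp add: integral_identity_def)
  \<comment> \<open>All radicands multiply to 2 pi x b * 2 / (pi b x) = 4.\<close>
  have pref: "sqrt (2 * pi) * (x powr (1/2) * b powr (1/2) * sqrt (2 / (pi * (b * x)))) = 2"
    if "x > 0" for x
    using that assms
    by (simp add: powr_half_sqrt flip: real_sqrt_mult)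
  have b32: "b powr (3/2) = b * b powr (1/2)"
    using assms powr_add[of b 1 "1/2"] by simp
  have part1: "integral_identity
          (\<lambda>x. sqrt (2 * pi) * (x powr (1/2 + real p) * exp (- a * x\<^sup>2)
                 * b powr (1/2) * bessel_I (1/2) (b * x)))
          (\<lambda>x. 2 * exp (- a * x\<^sup>2) * x ^ p * sinh (b * x))
          (\<lambda>x. V (int p) 0 a (- b) x - V (int p) 0 a b x)" if p: "p \<in> {0, 1, 2}" for p
  proof (rule integral_identityI)
    fix x :: real
    assume x: "x > 0"
    have "sqrt (2 * pi) * (x powr (1/2 + real p) * exp (- a * x\<^sup>2)
             * b powr (1/2) * bessel_I (1/2) (b * x))
        = sqrt (2 * pi) * (x powr (1/2) * b powr (1/2) * sqrt (2 / (pi * (b * x))))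
            * exp (- a * x\<^sup>2) * x ^ p * sinh (b * x)"
      using x assms by (simp only: bessel_I_one_half powr_add powr_realpow mult_pos_pos mult_ac)
    then show "sqrt (2 * pi) * (x powr (1/2 + real p) * exp (- a * x\<^sup>2)
             * b powr (1/2) * bessel_I (1/2) (b * x))
        = 2 * exp (- a * x\<^sup>2) * x ^ p * sinh (b * x)"
      unfolding pref[OF x] .
    have "((\<lambda>x. V (int p) 0 a (- b) x - V (int p) 0 a b x) has_real_derivative
        x ^ p * V_E a (- b) x - x ^ p * V_E a b x) (at x)"
      by (intro DERIV_diff has_real_derivative_V_nat assms p)
    also have "x ^ p * V_E a (- b) x - x ^ p * V_E a b x = x ^ p * (V_E a (- b) x - V_E a b x)"
      by (simp add: right_diff_distrib)
    also have "\<dots> = 2 * exp (- a * x\<^sup>2) * x ^ p * sinh (b * x)"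
      by (simp add: V_E_sinh_cosh)
    finally show "((\<lambda>x. V (int p) 0 a (- b) x - V (int p) 0 a b x) has_real_derivative
        2 * exp (- a * x\<^sup>2) * x ^ p * sinh (b * x)) (at x)" .
  qed
  \<comment> \<open>Serves (iii) directly and (ii) after division by x.\<close>
  have bessel: "sqrt (2 * pi) * (x powr (1/2) * exp (- a * x\<^sup>2)
              * b powr (3/2) * bessel_I (3/2) (b * x))
      = b * exp (- a * x\<^sup>2) * (2 * cosh (b * x) - 2 * sinh (b * x) / (b * x))" if x: "x > 0" for x
  proof -
    have "sqrt (2 * pi) * (x powr (1/2) * exp (- a * x\<^sup>2) * b powr (3/2) * bessel_I (3/2) (b * x))
        = sqrt (2 * pi) * (x powr (1/2) * b powr (1/2) * sqrt (2 / (pi * (b * x))))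
            * (b * exp (- a * x\<^sup>2) * (cosh (b * x) - sinh (b * x) / (b * x)))"
      using x assms by (simp only: bessel_I_three_halves b32 mult_pos_pos mult_ac)
    also have "\<dots> = b * exp (- a * x\<^sup>2) * (2 * cosh (b * x) - 2 * sinh (b * x) / (b * x))"
      unfolding pref[OF x] using assms by (simp add: algebra_simps)
    finally show ?thesis .
  qed
  define F where "F = (\<lambda>x.
            (sqrt pi * sqrt a * x * exp (b\<^sup>2 / (4 * a)) * erf ((2 * a * x - b) / (2 * sqrt a))
               + exp (b * x - a * x\<^sup>2)) / x
            - (sqrt pi * sqrt a * x * exp (b\<^sup>2 / (4 * a)) * erf ((2 * a * x + b) / (2 * sqrt a))
               + exp (- a * x\<^sup>2 - b * x)) / x)"
  have F_V: "F x = V (-1) 1 a b x - V (-1) 1 a (- b) x" if "x > 0" for x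
    using that by (simp add: F_def V_def V_E_def V_W_def add_divide_distrib)
  have part2: "integral_identity
           (\<lambda>x. sqrt (2 * pi) * (x powr (1/2 - 1) * exp (- a * x\<^sup>2)
                  * b powr (3/2) * bessel_I (3/2) (b * x)))
           (\<lambda>x. b / x * exp (- a * x\<^sup>2) * (2 * cosh (b * x) - 2 * sinh (b * x) / (b * x))) F"
  proof (rule integral_identityI)
    fix x :: real
    assume x: "x > 0"
    have "x powr (1/2 - 1) = x powr (1/2) / x"
      using x by (simp only: powr_diff powr_one)
    then have "sqrt (2 * pi) * (x powr (1/2 - 1) * exp (- a * x\<^sup>2)
                  * b powr (3/2) * bessel_I (3/2) (b * x))
        = sqrt (2 * pi) * (x powr (1/2) * exp (- a * x\<^sup>2)
                  * b powr (3/2) * bessel_I (3/2) (b * x)) / x"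
      by (simp only: times_divide_eq_left times_divide_eq_right)
    then show "sqrt (2 * pi) * (x powr (1/2 - 1) * exp (- a * x\<^sup>2)
                  * b powr (3/2) * bessel_I (3/2) (b * x))
        = b / x * exp (- a * x\<^sup>2) * (2 * cosh (b * x) - 2 * sinh (b * x) / (b * x))"
      unfolding bessel[OF x] by (simp only: times_divide_eq_left)
    have "((\<lambda>x. V (-1) 1 a b x - V (-1) 1 a (- b) x) has_real_derivative
        (b / x + 1 / x\<^sup>2) * V_E a b x - ((- b) / x + 1 / x\<^sup>2) * V_E a (- b) x) (at x)"
      by (intro DERIV_diff has_real_derivative_V_minus_one) (use assms x in auto)
    \<comment> \<open>Regrouping into the sum and the difference of the two exponentials exposes the
      cosh and sinh forms.\<close>
    also have "(b / x + 1 / x\<^sup>2) * V_E a b x - ((- b) / x + 1 / x\<^sup>2) * V_E a (- b) x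
        = b / x * (V_E a (- b) x + V_E a b x) - 1 / x\<^sup>2 * (V_E a (- b) x - V_E a b x)"
      by (simp add: algebra_simps)
    also have "\<dots> = b / x * exp (- a * x\<^sup>2) * (2 * cosh (b * x) - 2 * sinh (b * x) / (b * x))"
      unfolding V_E_sinh_cosh using x assms by (simp add: field_simps power2_eq_square)
    \<comment> \<open>\<open>F_V\<close> identifies F with the difference of V values on the
      positive axis, an open set containing x, so the derivative carries over.\<close>
    finally show "(F has_real_derivative
        b / x * exp (- a * x\<^sup>2) * (2 * cosh (b * x) - 2 * sinh (b * x) / (b * x))) (at x)"
      by (rule has_field_derivative_transform_within_open[of _ _ _ "{0<..}"]) (use x F_V in auto)
  qed
  have part3: "integral_identity
       (\<lambda>x. sqrt (2 * pi) * (x powr (1/2) * exp (- a * x\<^sup>2)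
              * b powr (3/2) * bessel_I (3/2) (b * x)))
       (\<lambda>x. b * exp (- a * x\<^sup>2) * (2 * cosh (b * x) - 2 * sinh (b * x) / (b * x)))
       (\<lambda>x. 2 * b * Upsilon_e 0 a b x + 2 * Upsilon_o 1 a b x)"
  proof (rule integral_identityI)
    fix x :: real
    assume x: "x > 0"
    have "((\<lambda>x. 2 * b * Upsilon_e 0 a b x + 2 * Upsilon_o 1 a b x) has_real_derivative
        2 * b * (exp (- a * x\<^sup>2) * cosh (b * x)) + 2 * - (exp (- a * x\<^sup>2) * sinh (b * x) / x)) (at x)"
      by (intro DERIV_add DERIV_cmult has_real_derivative_Upsilon_e has_real_derivative_Upsilon_o assms x)
    also have "2 * b * (exp (- a * x\<^sup>2) * cosh (b * x)) + 2 * - (exp (- a * x\<^sup>2) * sinh (b * x) / x)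
        = b * exp (- a * x\<^sup>2) * (2 * cosh (b * x) - 2 * sinh (b * x) / (b * x))"
      using x assms by (simp add: field_simps)
    finally show "((\<lambda>x. 2 * b * Upsilon_e 0 a b x + 2 * Upsilon_o 1 a b x) has_real_derivative
        b * exp (- a * x\<^sup>2) * (2 * cosh (b * x) - 2 * sinh (b * x) / (b * x))) (at x)" .
  qed (rule bessel)
  show ?thesis
    unfolding Let_def F_def[symmetric] using part1 part2 part3 F_V by blast
qed

end
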